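(* The tolerant learning hierarchy $\mathsf{TLH}$ is bounded (it has a least and a greatest element). Its bottom and top elements are respectively $[=^{\mathrm{ce}}]_{\equiv_{\mathrm{Learn}}}$ and $[\mathrm{Id}_1]_{\equiv_{\mathrm{Learn}}}$. In particular, $=^{\mathrm{ce}}$ is low and $\mathrm{Id}_1$ is universal.
   Context: Fix a standard (acceptable) enumeration $(\varphi_e)_{e\in\omega}$ of the partial computable functions and let $W_e=\operatorname{dom}(\varphi_e)$. Write $e=^{\mathrm{ce}}e'$ iff $W_e=W_{e'}$. Let $\mathcal{R}^{\mathrm{ce}}$ be the set of all equivalence relations on $\omega$ extending $=^{\mathrm{ce}}$ (no definability or effectivity is assumed). $\mathrm{Id}_1$ is the one-class equivalence relation on $\omega$. An enumeration of a set $A$ is a surjection $\mu:\omega\to A$; $\mu[s]$ denotes the finite string $\mu(0),\dots,\mu(s-1)$. A learner is an arbitrary function $\mathbf{M}:\omega^{<\omega}\to\omega$ (no effectivity is assumed). For $E^{\mathrm{ce}}\in\mathcal{R}^{\mathrm{ce}}$, a family $\mathfrak{K}$ of nonempty c.e. sets is $E^{\mathrm{ce}}$-learnable if there is a learner $\mathbf{M}$ such that for every $e$ with $W_e\in\mathfrak{K}$ and every enumeration $\mu$ of $W_e$ there is $i\in\omega$ with $i\mathrel{E^{\mathrm{ce}}}e$ and $\mathbf{M}(\mu[s])=i$ for all sufficiently large $s$. $E^{\mathrm{ce}}\leq_{\mathrm{Learn}}F^{\mathrm{ce}}$ means that every $E^{\mathrm{ce}}$-learnable family of nonempty c.e. sets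 is also $F^{\mathrm{ce}}$-learnable; $E^{\mathrm{ce}}\equiv_{\mathrm{Learn}}F^{\mathrm{ce}}$ means both $E^{\mathrm{ce}}\leq_{\mathrm{Learn}}F^{\mathrm{ce}}$ and $F^{\mathrm{ce}}\leq_{\mathrm{Learn}}E^{\mathrm{ce}}$. The tolerant learning hierarchy $\mathsf{TLH}$ is the poset $(\mathcal{E}^{\mathrm{ce}},\leq)$ where $\mathcal{E}^{\mathrm{ce}}=\mathcal{R}^{\mathrm{ce}}/{\equiv_{\mathrm{Learn}}}$ and $\leq$ is induced by $\leq_{\mathrm{Learn}}$. $E^{\mathrm{ce}}$ is low if $E^{\mathrm{ce}}\equiv_{\mathrm{Learn}}{=^{\mathrm{ce}}}$, and universal if every family of nonempty c.e. sets is $E^{\mathrm{ce}}$-learnable. *)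

theory Defs
  imports Complex_Main "HOL-Algebra.Order"
begin

section \<open>Partial computable functions and acceptable enumerations\<close>

datatype recf = Zero | Succ | Proj nat | Comp recf "recf list" | Prec recf recf | Mu recf

text \<open>
  Kleene's \<open>\<mu>\<close>-recursive functions: \<open>recf_eval p xs y\<close> says that the partial function described
  by \<open>p\<close> is defined on the argument tuple \<open>xs\<close>, with value \<open>y\<close>. The recursion argument of \<open>Prec\<close>
  and the search argument of \<open>Mu\<close> come first. Terms carry no arity; restricted to tuples of
  length \<open>n\<close>, every term describes an \<open>n\<close>-ary partial recursive function (nowhere defined if the
  arities do not match), and all of them arise in this way.
\<close>

inductive recf_eval :: "recf \<Rightarrow> nat list \<Rightarrow> nat \<Rightarrow> bool" where
  "recf_eval Zero xs 0"
| "recf_eval Succ [x] (Suc x)"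
| "i < length xs \<Longrightarrow> recf_eval (Proj i) xs (xs ! i)"
| "list_all2 (\<lambda>g y. recf_eval g xs y) gs ys \<Longrightarrow> recf_eval f ys z \<Longrightarrow> recf_eval (Comp f gs) xs z"
| "recf_eval f xs z \<Longrightarrow> recf_eval (Prec f g) (0 # xs) z"
| "recf_eval (Prec f g) (n # xs) y \<Longrightarrow> recf_eval g (n # y # xs) z
    \<Longrightarrow> recf_eval (Prec f g) (Suc n # xs) z"
| "recf_eval f (n # xs) 0 \<Longrightarrow> (\<forall>m<n. \<exists>y>0. recf_eval f (m # xs) y) \<Longrightarrow> recf_eval (Mu f) xs n"

definition partial_computable :: "(nat \<Rightarrow> nat option) \<Rightarrow> bool" where
  "partial_computable \<psi> \<longleftrightarrow> (\<exists>p. \<forall>x y. \<psi> x = Some y \<longleftrightarrow> recf_eval p [x] y)"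

definition partial_computable2 :: "(nat \<Rightarrow> nat \<Rightarrow> nat option) \<Rightarrow> bool" where
  "partial_computable2 \<psi> \<longleftrightarrow> (\<exists>p. \<forall>e x y. \<psi> e x = Some y \<longleftrightarrow> recf_eval p [e, x] y)"

definition total_computable :: "(nat \<Rightarrow> nat) \<Rightarrow> bool" where
  "total_computable f \<longleftrightarrow> partial_computable (\<lambda>x. Some (f x))"

text \<open>
  Acceptability in the sense of Rogers: the enumeration has a partial computable universal
  function, and every uniformly partial computable sequence reduces to it computably (s-m-n).
\<close>

definition acceptable :: "(nat \<Rightarrow> nat \<Rightarrow> nat option) \<Rightarrow> bool" where
  "acceptable \<phi> \<longleftrightarrow>
     range \<phi> = {\<psi>. partial_computable \<psi>} \<and>
     partial_computable2 \<phi> \<and>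
     (\<forall>\<psi>. partial_computable2 \<psi> \<longrightarrow> (\<exists>f. total_computable f \<and> (\<forall>e. \<phi> (f e) = \<psi> e)))"

definition W :: "(nat \<Rightarrow> nat \<Rightarrow> nat option) \<Rightarrow> nat \<Rightarrow> nat set" where
  "W \<phi> e = dom (\<phi> e)"


section \<open>Tolerant learning\<close>

definition ce_eq :: "(nat \<Rightarrow> nat \<Rightarrow> nat option) \<Rightarrow> (nat \<times> nat) set" where
  "ce_eq \<phi> = {(e, e'). W \<phi> e = W \<phi> e'}"

definition Rce :: "(nat \<Rightarrow> nat \<Rightarrow> nat option) \<Rightarrow> (nat \<times> nat) set set" where
  "Rce \<phi> = {E. equiv UNIV E \<and> ce_eq \<phi> \<subseteq> E}"

definition Id1 :: "(nat \<times> nat) set" where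
  "Id1 = UNIV"

definition ce_family :: "(nat \<Rightarrow> nat \<Rightarrow> nat option) \<Rightarrow> nat set set \<Rightarrow> bool" where
  "ce_family \<phi> K \<longleftrightarrow> (\<forall>A\<in>K. A \<noteq> {} \<and> (\<exists>e. A = W \<phi> e))"

definition enumeration_of :: "(nat \<Rightarrow> nat) \<Rightarrow> nat set \<Rightarrow> bool" where
  "enumeration_of \<mu> A \<longleftrightarrow> range \<mu> = A"

definition init_seg :: "(nat \<Rightarrow> nat) \<Rightarrow> nat \<Rightarrow> nat list" where
  "init_seg \<mu> s = map \<mu> [0..<s]"

definition learnable ::
    "(nat \<Rightarrow> nat \<Rightarrow> nat option) \<Rightarrow> (nat \<times> nat) set \<Rightarrow> nat set set \<Rightarrow> bool" where
  "learnable \<phi> E K \<longleftrightarrow>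
     (\<exists>M :: nat list \<Rightarrow> nat. \<forall>e. W \<phi> e \<in> K \<longrightarrow>
        (\<forall>\<mu>. enumeration_of \<mu> (W \<phi> e) \<longrightarrow>
           (\<exists>i. (i, e) \<in> E \<and> (\<forall>\<^sub>F s in sequentially. M (init_seg \<mu> s) = i))))"

definition learn_le ::
    "(nat \<Rightarrow> nat \<Rightarrow> nat option) \<Rightarrow> (nat \<times> nat) set \<Rightarrow> (nat \<times> nat) set \<Rightarrow> bool" where
  "learn_le \<phi> E F \<longleftrightarrow> (\<forall>K. ce_family \<phi> K \<longrightarrow> learnable \<phi> E K \<longrightarrow> learnable \<phi> F K)"

definition learn_equiv ::
    "(nat \<Rightarrow> nat \<Rightarrow> nat option) \<Rightarrow> ((nat \<times> nat) set \<times> (nat \<times> nat) set) set" where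
  "learn_equiv \<phi> =
     {(E, F). E \<in> Rce \<phi> \<and> F \<in> Rce \<phi> \<and> learn_le \<phi> E F \<and> learn_le \<phi> F E}"

definition low :: "(nat \<Rightarrow> nat \<Rightarrow> nat option) \<Rightarrow> (nat \<times> nat) set \<Rightarrow> bool" where
  "low \<phi> E \<longleftrightarrow> (E, ce_eq \<phi>) \<in> learn_equiv \<phi>"

definition universal :: "(nat \<Rightarrow> nat \<Rightarrow> nat option) \<Rightarrow> (nat \<times> nat) set \<Rightarrow> bool" where
  "universal \<phi> E \<longleftrightarrow> E \<in> Rce \<phi> \<and> (\<forall>K. ce_family \<phi> K \<longrightarrow> learnable \<phi> E K)"

definition learn_class ::
    "(nat \<Rightarrow> nat \<Rightarrow> nat option) \<Rightarrow> (nat \<times> nat) set \<Rightarrow> (nat \<times> nat) set set" where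
  "learn_class \<phi> E = learn_equiv \<phi> `` {E}"

definition TLH :: "(nat \<Rightarrow> nat \<Rightarrow> nat option) \<Rightarrow> (nat \<times> nat) set set gorder" where
  "TLH \<phi> =
     \<lparr> carrier = Rce \<phi> // learn_equiv \<phi>,
       eq = (=),
       le = (\<lambda>A B. \<exists>E\<in>A. \<exists>F\<in>B. learn_le \<phi> E F) \<rparr>"

text \<open>The quotient is by an equivalence relation, and its order does not depend on representatives.\<close>

lemma learn_le_refl: "learn_le \<phi> E E"
  by (simp add: learn_le_def)

lemma learn_le_trans: "learn_le \<phi> E F \<Longrightarrow> learn_le \<phi> F G \<Longrightarrow> learn_le \<phi> E G"
  by (simp add: learn_le_def)

lemma equiv_learn_equiv: "equiv (Rce \<phi>) (learn_equiv \<phi>)"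
proof (rule equivI)
  show "learn_equiv \<phi> \<subseteq> Rce \<phi> \<times> Rce \<phi>"
    unfolding learn_equiv_def by blast
  show "refl_on (Rce \<phi>) (learn_equiv \<phi>)"
    unfolding learn_equiv_def refl_on_def using learn_le_refl by blast
  show "sym (learn_equiv \<phi>)"
    unfolding learn_equiv_def sym_def by blast
  show "trans (learn_equiv \<phi>)"
    unfolding learn_equiv_def trans_def using learn_le_trans by blast
qed

lemma TLH_le_iff:
  assumes "E \<in> Rce \<phi>" "F \<in> Rce \<phi>"
  shows "learn_class \<phi> E \<sqsubseteq>\<^bsub>TLH \<phi>\<^esub> learn_class \<phi> F \<longleftrightarrow> learn_le \<phi> E F"
proof -
  have "learn_class \<phi> E \<sqsubseteq>\<^bsub>TLH \<phi>\<^esub> learn_class \<phi> F \<longleftrightarrow>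
      (\<exists>E'\<in>learn_class \<phi> E. \<exists>F'\<in>learn_class \<phi> F. learn_le \<phi> E' F')"
    by (simp add: TLH_def)
  also have "\<dots> \<longleftrightarrow> learn_le \<phi> E F"
    using assms unfolding learn_class_def learn_equiv_def
    by (blast intro: learn_le_refl dest: learn_le_trans)
  finally show ?thesis .
qed

end

theory Submission
  imports Defs
begin

text \<open>Coarsening the equivalence relation only relaxes the success condition: a learner
  correct up to \<open>E\<close> is correct up to every \<open>F\<close> containing
  \<open>E\<close>. So inclusion implies \<open>learn_le\<close> (\<open>learn_le_mono\<close>).
  Every member of \<open>Rce \<phi>\<close> lies between \<open>ce_eq \<phi>\<close> and
  \<open>Id1\<close> under inclusion, and both of these are members, so their classes are extremal.
  Universality of \<open>Id1\<close> is witnessed by a constant learner.\<close>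

lemma learn_le_mono: "E \<subseteq> F \<Longrightarrow> learn_le \<phi> E F"
  unfolding learn_le_def learnable_def by fast

lemma ce_eq_in_Rce: "ce_eq \<phi> \<in> Rce \<phi>"
  unfolding Rce_def ce_eq_def by (auto intro!: equivI refl_onI symI transI)

lemma Id1_in_Rce: "Id1 \<in> Rce \<phi>"
  unfolding Rce_def Id1_def by (auto intro!: equivI refl_onI symI transI)

lemma ce_eq_learn_le: "E \<in> Rce \<phi> \<Longrightarrow> learn_le \<phi> (ce_eq \<phi>) E"
  by (simp add: learn_le_mono Rce_def)

lemma learn_le_Id1: "learn_le \<phi> E Id1"
  by (simp add: learn_le_mono Id1_def)

text \<open>\<open>Id1\<close> relates every conjecture to every index, so the learner only has to
  converge; the constant 0 does.\<close>

lemma learnable_Id1: "learnable \<phi> Id1 K"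
  unfolding learnable_def Id1_def by (auto intro!: exI[of _ "\<lambda>_. 0"])

text \<open>Lets each point of the quotient be replaced by a representative, so that
  \<open>TLH_le_iff\<close> applies.\<close>

lemma carrier_TLH_eq: "carrier (TLH \<phi>) = learn_class \<phi> ` Rce \<phi>"
  by (auto simp: TLH_def learn_class_def quotient_def)

lemma learn_class_eqI:
  assumes "E \<in> Rce \<phi>" "F \<in> Rce \<phi>" "learn_le \<phi> E F" "learn_le \<phi> F E"
  shows "learn_class \<phi> E = learn_class \<phi> F"
  unfolding learn_class_def
  by (rule equiv_class_eq[OF equiv_learn_equiv]) (simp add: assms learn_equiv_def)

lemma partial_order_TLH: "partial_order (TLH \<phi>)"
proof -
  have eq: "eq (TLH \<phi>) = (=)"
    by (simp add: TLH_def)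
  show ?thesis
  proof (unfold_locales, goal_cases)
    \<comment> \<open>Cases 4, 5 and 6 are reflexivity, antisymmetry and transitivity; the other
      goals concern \<open>eq\<close>, which is plain equality. Antisymmetry holds because mutual
      \<open>learn_le\<close> is exactly the relation being factored out.\<close>
    case (4 x)
    then show ?case by (auto simp: carrier_TLH_eq TLH_le_iff learn_le_refl)
  next
    case (5 x y)
    then obtain E F where "E \<in> Rce \<phi>" "F \<in> Rce \<phi>" "x = learn_class \<phi> E" "y = learn_class \<phi> F"
      unfolding carrier_TLH_eq by blast
    with 5 show ?case using learn_class_eqI[of E \<phi> F] by (simp add: eq TLH_le_iff)
  next
    case (6 x y z)
    then obtain E F G where "E \<in> Rce \<phi>" "F \<in> Rce \<phi>" "G \<in> Rce \<phi>"
        "x = learn_class \<phi> E" "y = learn_class \<phi> F" "z = learn_class \<phi> G"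
      unfolding carrier_TLH_eq by blast
    with 6 show ?case using learn_le_trans[of \<phi> E F G] by (simp add: TLH_le_iff)
  qed (simp_all add: eq)
qed

lemma least_ce_eq: "least (TLH \<phi>) (learn_class \<phi> (ce_eq \<phi>)) (carrier (TLH \<phi>))"
  using ce_eq_in_Rce[of \<phi>]
  by (auto simp: least_def carrier_TLH_eq TLH_le_iff ce_eq_learn_le)

lemma greatest_Id1: "greatest (TLH \<phi>) (learn_class \<phi> Id1) (carrier (TLH \<phi>))"
  using Id1_in_Rce[of \<phi>]
  by (auto simp: greatest_def carrier_TLH_eq TLH_le_iff learn_le_Id1)

theorem proposition4p2:
  fixes \<phi> :: "nat \<Rightarrow> nat \<Rightarrow> nat option"
  assumes "acceptable \<phi>"
  shows "partial_order (TLH \<phi>)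
    \<and> (\<exists>b. least (TLH \<phi>) b (carrier (TLH \<phi>)))
    \<and> (\<exists>t. greatest (TLH \<phi>) t (carrier (TLH \<phi>)))
    \<and> \<bottom>\<^bsub>TLH \<phi>\<^esub> = learn_class \<phi> (ce_eq \<phi>)
    \<and> \<top>\<^bsub>TLH \<phi>\<^esub> = learn_class \<phi> Id1
    \<and> low \<phi> (ce_eq \<phi>)
    \<and> universal \<phi> Id1"
proof -
  interpret partial_order "TLH \<phi>"
    by (rule partial_order_TLH)
  have "\<bottom>\<^bsub>TLH \<phi>\<^esub> = learn_class \<phi> (ce_eq \<phi>)"
    \<comment> \<open>\<open>\<bottom>\<close> is a Hilbert choice among least elements, so it is
      identified by uniqueness, which comes from antisymmetry; dually for
      \<open>\<top>\<close>.\<close>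
    unfolding bottom_def
    by (rule some_equality[of "\<lambda>b. least (TLH \<phi>) b (carrier (TLH \<phi>))", OF least_ce_eq])
      (rule least_unique[OF _ least_ce_eq])
  moreover have "\<top>\<^bsub>TLH \<phi>\<^esub> = learn_class \<phi> Id1"
    unfolding top_def
    by (rule some_equality[of "\<lambda>t. greatest (TLH \<phi>) t (carrier (TLH \<phi>))", OF greatest_Id1])
      (rule greatest_unique[OF _ greatest_Id1])
  moreover have "low \<phi> (ce_eq \<phi>)"
    by (simp add: low_def learn_equiv_def ce_eq_in_Rce learn_le_refl)
  moreover have "universal \<phi> Id1"
    by (simp add: universal_def Id1_in_Rce learnable_Id1)
  ultimately show ?thesis
    using partial_order_TLH least_ce_eq greatest_Id1 by blast
qed

end
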